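(* Let $V=\{1,\dots,n\}$, $m\ge1$, and let $f_1,\dots,f_m:2^V\to\mathbb{R}$ be normalized, monotone non-decreasing, submodular functions with Lovász extensions $\tilde f_1,\dots,\tilde f_m$. Let $(x_1^*,\dots,x_m^* )$ be an optimal solution of the convex program $$\min_{x_1,\dots,x_m\in[0,1]^n}\ \max_i \tilde f_i(x_i)\quad\text{s.t.}\quad \sum_{i=1}^m x_i(j)\ge1\ \text{ for } j=1,\dots,n,$$ and let $\hat\pi=(A_1,\dots,A_m)$ be obtained by assigning each $j\in V$ to one block $\hat i\in\arg\max_i x_i^*(j)$ (ties broken arbitrarily). Then $$\max_i f_i(A_i^{\hat\pi})\ \le\ m\min_{\pi\in\Pi}\max_i f_i(A_i^\pi).$$
   Context: $f$ is normalized if $f(\emptyset)=0$, monotone non-decreasing if $f(S)\le f(T)$ for $S\subseteq T$, submodular if $f(S)+f(T)\ge f(S\cup T)+f(S\cap T)$. $\Pi$ is the set of ordered partitions of $V$ into $m$ pairwise disjoint (possibly empty) blocks covering $V$. The Lovász extension of $f$: for $x\in[0,1]^n$, let $\sigma_x$ order the coordinates of $x$ non-increasingly, $S_j=\{\sigma_x(1),\dots,\sigma_x(j)\}$, $S_0=\emptyset$; then $\tilde f(x)=\sum_{j=1}^n x(\sigma_x(j))\,(f(S_j)-f(S_{j-1}))$. *)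

theory Defs
  imports Complex_Main "HOL-Library.FuncSet" "HOL-Library.Multiset" "HOL-Library.Disjoint_Sets"
begin

definition submodular_on :: "'a set \<Rightarrow> ('a set \<Rightarrow> real) \<Rightarrow> bool" where
  "submodular_on V f \<longleftrightarrow>
     (\<forall>S T. S \<subseteq> V \<longrightarrow> T \<subseteq> V \<longrightarrow> f S + f T \<ge> f (S \<union> T) + f (S \<inter> T))"

text \<open>
  Real vectors of dimension \<open>n\<close> are functions of type \<^typ>\<open>nat \<Rightarrow> real\<close> of which only the values on
  \<open>{1..n}\<close> matter.
\<close>

definition orders_nonincreasingly :: "nat \<Rightarrow> (nat \<Rightarrow> real) \<Rightarrow> (nat \<Rightarrow> nat) \<Rightarrow> bool" where
  "orders_nonincreasingly n x \<sigma> \<longleftrightarrow>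
     bij_betw \<sigma> {1..n} {1..n} \<and>
     (\<forall>j\<in>{1..n}. \<forall>k\<in>{1..n}. j \<le> k \<longrightarrow> x (\<sigma> k) \<le> x (\<sigma> j))"

definition lovasz_sum ::
  "nat \<Rightarrow> (nat set \<Rightarrow> real) \<Rightarrow> (nat \<Rightarrow> real) \<Rightarrow> (nat \<Rightarrow> nat) \<Rightarrow> real" where
  "lovasz_sum n f x \<sigma> = (\<Sum>j=1..n. x (\<sigma> j) * (f (\<sigma> ` {1..j}) - f (\<sigma> ` {1..j - 1})))"

text \<open>
  The ordering is not unique if \<open>x\<close> has ties; \<open>lovasz_ext_eq\<close> below shows that the choice of
  ordering does not matter.
\<close>

definition lovasz_ext :: "nat \<Rightarrow> (nat set \<Rightarrow> real) \<Rightarrow> (nat \<Rightarrow> real) \<Rightarrow> real" where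
  "lovasz_ext n f x = lovasz_sum n f x (SOME \<sigma>. orders_nonincreasingly n x \<sigma>)"

definition feasible :: "nat \<Rightarrow> nat \<Rightarrow> (nat \<Rightarrow> nat \<Rightarrow> real) \<Rightarrow> bool" where
  "feasible n m x \<longleftrightarrow>
     (\<forall>i\<in>{1..m}. \<forall>j\<in>{1..n}. x i j \<in> {0..1}) \<and>
     (\<forall>j\<in>{1..n}. (\<Sum>i=1..m. x i j) \<ge> 1)"

definition ordered_partitions :: "nat \<Rightarrow> nat \<Rightarrow> (nat \<Rightarrow> nat set) set" where
  "ordered_partitions n m =
     {A \<in> {1..m} \<rightarrow>\<^sub>E Pow {1..n}. disjoint_family_on A {1..m} \<and> (\<Union>i\<in>{1..m}. A i) = {1..n}}"

lemma orders_nonincreasingly_exists: "\<exists>\<sigma>. orders_nonincreasingly n x \<sigma>"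
proof -
  define xs where "xs = sort_key (\<lambda>j. - x j) [1..<Suc n]"
  have len: "length xs = n" and dist: "distinct xs" and set: "set xs = {1..n}"
    by (auto simp: xs_def)
  have sorted: "sorted (map (\<lambda>j. - x j) xs)"
    by (simp add: xs_def)
  have shift: "bij_betw (\<lambda>j. j - 1) {1..n} {..<n}"
    by (rule bij_betwI[where g = Suc]) auto
  have "bij_betw ((!) xs) {..<n} {1..n}"
    using bij_betw_nth[OF dist, of "{..<n}" "{1..n}"] len set by simp
  from bij_betw_trans[OF shift this]
  have "bij_betw (\<lambda>j. xs ! (j - 1)) {1..n} {1..n}"
    by (simp add: comp_def)
  moreover have "x (xs ! (k - 1)) \<le> x (xs ! (j - 1))"
    if "j \<in> {1..n}" "k \<in> {1..n}" "j \<le> k" for j k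
    using sorted_nth_mono[OF sorted, of "j - 1" "k - 1"] that len by auto
  ultimately show ?thesis
    unfolding orders_nonincreasingly_def by blast
qed

lemma orders_nonincreasingly_values_unique:
  assumes "orders_nonincreasingly n x \<sigma>" "orders_nonincreasingly n x \<tau>" "j \<in> {1..n}"
  shows "x (\<sigma> j) = x (\<tau> j)"
proof -
  have sort: "map (\<lambda>j. - x (\<rho> j)) [1..<Suc n] = sort (map (\<lambda>j. - x j) [1..<Suc n])"
    if \<rho>: "orders_nonincreasingly n x \<rho>" for \<rho>
  proof (rule properties_for_sort[symmetric])
    have "mset (map \<rho> [1..<Suc n]) = mset [1..<Suc n]"
    proof (rule set_eq_iff_mset_eq_distinct[THEN iffD1])
      have "bij_betw \<rho> {1..<Suc n} {1..<Suc n}"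
        using \<rho> by (simp add: orders_nonincreasingly_def atLeastLessThanSuc_atLeastAtMost)
      then show "distinct (map \<rho> [1..<Suc n])" "set (map \<rho> [1..<Suc n]) = set [1..<Suc n]"
        by (auto simp: distinct_map bij_betw_def simp del: upt_Suc)
    qed simp
    then have "image_mset (\<lambda>j. - x j) (mset (map \<rho> [1..<Suc n]))
             = image_mset (\<lambda>j. - x j) (mset [1..<Suc n])"
      by (rule arg_cong)
    then show "mset (map (\<lambda>j. - x (\<rho> j)) [1..<Suc n]) = mset (map (\<lambda>j. - x j) [1..<Suc n])"
      by (simp add: multiset.map_comp comp_def del: upt_Suc)
    show "sorted (map (\<lambda>j. - x (\<rho> j)) [1..<Suc n])"
      using \<rho> by (auto simp: orders_nonincreasingly_def sorted_iff_nth_mono simp del: upt_Suc)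
  qed
  have "map (\<lambda>j. - x (\<sigma> j)) [1..<Suc n] = map (\<lambda>j. - x (\<tau> j)) [1..<Suc n]"
    using sort assms by simp
  then show ?thesis
    using assms(3) by (auto simp: atLeastLessThanSuc_atLeastAtMost simp del: upt_Suc)
qed

lemma lovasz_sum_by_parts:
  "lovasz_sum n f x \<sigma> =
     x (\<sigma> n) * f (\<sigma> ` {1..n}) - x (\<sigma> 1) * f {}
     + (\<Sum>j=1..<n. (x (\<sigma> j) - x (\<sigma> (Suc j))) * f (\<sigma> ` {1..j}))" if "n \<ge> 1"
  using that
proof (induction n rule: nat_induct_at_least)
  case base
  then show ?case by (simp add: lovasz_sum_def algebra_simps)
next
  case (Suc n)
  then show ?case
    by (simp add: lovasz_sum_def algebra_simps)
qed

lemma lovasz_sum_unique: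
  assumes "orders_nonincreasingly n x \<sigma>" "orders_nonincreasingly n x \<tau>"
  shows "lovasz_sum n f x \<sigma> = lovasz_sum n f x \<tau>"
proof (cases "n \<ge> 1")
  case False
  then show ?thesis by (simp add: lovasz_sum_def)
next
  case True
  note val = orders_nonincreasingly_values_unique[OF assms]
  have level: "\<rho> ` {1..j} = {v\<in>{1..n}. x v \<ge> x (\<rho> j)}"
    if \<rho>: "orders_nonincreasingly n x \<rho>" and j: "j \<in> {1..<n}" "x (\<rho> j) \<noteq> x (\<rho> (Suc j))" for \<rho> j
  proof -
    have bij: "bij_betw \<rho> {1..n} {1..n}"
      and mono: "\<And>j k. \<lbrakk>j \<in> {1..n}; k \<in> {1..n}; j \<le> k\<rbrakk> \<Longrightarrow> x (\<rho> k) \<le> x (\<rho> j)"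
      using \<rho> by (auto simp: orders_nonincreasingly_def)
    have gap: "x (\<rho> (Suc j)) < x (\<rho> j)"
      using mono[of j "Suc j"] j by auto
    show ?thesis
    proof (intro equalityI subsetI)
      fix v assume "v \<in> \<rho> ` {1..j}"
      then obtain k where "k \<in> {1..j}" "v = \<rho> k" by auto
      then show "v \<in> {v\<in>{1..n}. x v \<ge> x (\<rho> j)}"
        using mono[of k j] j bij_betwE[OF bij] by auto
    next
      fix v assume v: "v \<in> {v\<in>{1..n}. x v \<ge> x (\<rho> j)}"
      then obtain k where k: "k \<in> {1..n}" "v = \<rho> k"
        using bij_betw_imp_surj_on[OF bij] by blast
      have "k \<le> j"
      proof (rule ccontr)
        assume "\<not> k \<le> j"
        then have "x (\<rho> k) \<le> x (\<rho> (Suc j))"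
          using mono[of "Suc j" k] k j by auto
        then show False using gap v k by auto
      qed
      then show "v \<in> \<rho> ` {1..j}" using k by auto
    qed
  qed
  have "(x (\<sigma> j) - x (\<sigma> (Suc j))) * f (\<sigma> ` {1..j}) = (x (\<tau> j) - x (\<tau> (Suc j))) * f (\<tau> ` {1..j})"
    if j: "j \<in> {1..<n}" for j
  proof (cases "x (\<sigma> j) = x (\<sigma> (Suc j))")
    case True
    then show ?thesis using val[of j] val[of "Suc j"] j by simp
  next
    case False
    then show ?thesis
      using level[OF assms(1) j] level[OF assms(2) j] val[of j] val[of "Suc j"] j by simp
  qed
  then have "(\<Sum>j=1..<n. (x (\<sigma> j) - x (\<sigma> (Suc j))) * f (\<sigma> ` {1..j}))
           = (\<Sum>j=1..<n. (x (\<tau> j) - x (\<tau> (Suc j))) * f (\<tau> ` {1..j}))"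
    by (intro sum.cong) auto
  moreover have "\<sigma> ` {1..n} = \<tau> ` {1..n}"
    using assms by (simp add: orders_nonincreasingly_def bij_betw_def)
  ultimately show ?thesis
    unfolding lovasz_sum_by_parts[OF True] using val[of 1] val[of n] True by simp
qed

lemma lovasz_ext_eq:
  assumes "orders_nonincreasingly n x \<sigma>"
  shows "lovasz_ext n f x = lovasz_sum n f x \<sigma>"
  unfolding lovasz_ext_def
  by (rule lovasz_sum_unique[OF someI_ex[OF orders_nonincreasingly_exists] assms])

end

theory Submission
  imports Defs
begin

text \<open>
  Monotonicity alone gives \<open>t f(S) \<le> f\<^sup>~(x)\<close> whenever \<open>x \<ge> 0\<close> is at least \<open>t \<ge> 0\<close> on \<open>S\<close>.
  A maximal coordinate among \<open>m\<close> numbers of sum at least 1 is at least \<open>1/m\<close>, so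
  \<open>f\<^sub>i(A\<^sub>i) \<le> m f\<^sub>i\<^sup>~(x\<^sub>i)\<close>.
  The Lovasz extension agrees with \<open>f\<close> on indicator vectors, so every partition is a feasible point
  with the same objective value, and the optimum of the convex program is a lower bound.
\<close>

text \<open>The values \<open>x (\<sigma> j)\<close> do not increase with \<open>j\<close>, so the
  positions with value at least \<open>t\<close> form an initial segment. Every superlevel set of
  \<open>x\<close> is therefore a member of the chain that defines the Lovasz extension.\<close>

lemma orders_nonincreasingly_superlevel:
  assumes "orders_nonincreasingly n x \<sigma>"
  obtains k where "k \<le> n" "\<And>j. j \<in> {1..n} \<Longrightarrow> t \<le> x (\<sigma> j) \<longleftrightarrow> j \<le> k"
    "\<sigma> ` {1..k} = {v \<in> {1..n}. t \<le> x v}"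
proof -
  have bij: "\<sigma> ` {1..n} = {1..n}"
    and anti: "\<And>j k. \<lbrakk>j \<in> {1..n}; k \<in> {1..n}; j \<le> k\<rbrakk> \<Longrightarrow> x (\<sigma> k) \<le> x (\<sigma> j)"
    using assms by (auto simp: orders_nonincreasingly_def bij_betw_def)
  \<comment> \<open>The default 0 keeps \<open>Max K\<close> defined when no coordinate reaches
    \<open>t\<close>; then \<open>{1..k}\<close> is empty, as it should be.\<close>
  define K where "K = insert 0 {j \<in> {1..n}. t \<le> x (\<sigma> j)}"
  define k where "k = Max K"
  have fin: "finite K" by (simp add: K_def)
  have kK: "k \<in> K" unfolding k_def by (rule Max_in) (use fin in \<open>auto simp: K_def\<close>)
  have kn: "k \<le> n" using kK by (auto simp: K_def)
  have iff: "t \<le> x (\<sigma> j) \<longleftrightarrow> j \<le> k" if j: "j \<in> {1..n}" for j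
  proof
    assume "t \<le> x (\<sigma> j)"
    then show "j \<le> k" unfolding k_def using fin j by (auto simp: K_def)
  next
    assume "j \<le> k"
    \<comment> \<open>From \<open>1 \<le> j \<le> k\<close> it follows that \<open>k\<close> is not
      the default 0, so it is a position where \<open>t\<close> is reached.\<close>
    then have "x (\<sigma> k) \<le> x (\<sigma> j)" "t \<le> x (\<sigma> k)"
      using anti[of j k] j kK by (auto simp: K_def)
    then show "t \<le> x (\<sigma> j)" by linarith
  qed
  have "\<sigma> ` {1..k} = \<sigma> ` {j \<in> {1..n}. t \<le> x (\<sigma> j)}"
    using iff kn by (intro arg_cong[where f = "image \<sigma>"]) auto
  also have "\<dots> = {v \<in> \<sigma> ` {1..n}. t \<le> x v}" by blast
  finally have "\<sigma> ` {1..k} = {v \<in> {1..n}. t \<le> x v}" by (simp only: bij)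
  with kn iff show ?thesis by (rule that)
qed

lemma sum_marginals:
  fixes f :: "'a set \<Rightarrow> real" and k :: nat
  shows "(\<Sum>j=1..k. f (\<sigma> ` {1..j}) - f (\<sigma> ` {1..j - 1})) = f (\<sigma> ` {1..k}) - f {}"
  by (induction k) auto

lemma lovasz_ext_ge_superlevel:
  assumes norm: "f {} = 0" and mono: "mono_on (Pow {1..n}) f"
    and nonneg: "\<And>j. j \<in> {1..n} \<Longrightarrow> 0 \<le> x j" and "0 \<le> t"
    and S: "S \<subseteq> {1..n}" "\<And>j. j \<in> S \<Longrightarrow> t \<le> x j"
  shows "t * f S \<le> lovasz_ext n f x"
proof -
  obtain \<sigma> where \<sigma>: "orders_nonincreasingly n x \<sigma>"
    using orders_nonincreasingly_exists by blast
  obtain k where k: "k \<le> n" "\<And>j. j \<in> {1..n} \<Longrightarrow> t \<le> x (\<sigma> j) \<longleftrightarrow> j \<le> k"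
    "\<sigma> ` {1..k} = {v \<in> {1..n}. t \<le> x v}"
    using orders_nonincreasingly_superlevel[OF \<sigma>] by blast
  have in_V: "\<sigma> j \<in> {1..n}" if "j \<in> {1..n}" for j
    using \<sigma> that by (auto simp: orders_nonincreasingly_def bij_betw_def)
  let ?d = "\<lambda>j. f (\<sigma> ` {1..j}) - f (\<sigma> ` {1..j - 1})"
  have d: "0 \<le> ?d j" if "j \<in> {1..n}" for j
  proof -
    have "\<sigma> ` {1..j - 1} \<subseteq> \<sigma> ` {1..j}" by (rule image_mono) auto
    moreover have "\<sigma> ` {1..j} \<subseteq> {1..n}" using in_V that by force
    ultimately have "f (\<sigma> ` {1..j - 1}) \<le> f (\<sigma> ` {1..j})"
      by (intro mono_onD[OF mono]) auto
    then show ?thesis by simp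
  qed
  have "f S \<le> f (\<sigma> ` {1..k})"
    unfolding k(3) using S by (intro mono_onD[OF mono]) auto
  then have "t * f S \<le> t * f (\<sigma> ` {1..k})"
    using \<open>0 \<le> t\<close> by (rule mult_left_mono)
  also have "\<dots> = (\<Sum>j=1..k. t * ?d j)"
    using sum_marginals[of f \<sigma> k] norm by (simp add: sum_distrib_left[symmetric])
  also have "\<dots> \<le> (\<Sum>j=1..k. x (\<sigma> j) * ?d j)"
    using k d by (intro sum_mono mult_right_mono) auto
  also have "\<dots> \<le> (\<Sum>j=1..n. x (\<sigma> j) * ?d j)"
    using k(1) d nonneg in_V by (intro sum_mono2 mult_nonneg_nonneg) auto
  finally show ?thesis
    by (simp add: lovasz_ext_eq[OF \<sigma>] lovasz_sum_def)
qed

text \<open>A nonincreasing order lists \<open>S\<close> first, so the weights are 1 up to position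
  \<open>k = card S\<close> and 0 afterwards, and the sum telescopes to \<open>f S\<close>.\<close>

lemma lovasz_ext_indicator:
  assumes norm: "f {} = 0" and S: "S \<subseteq> {1..n}"
  shows "lovasz_ext n f (\<lambda>j. of_bool (j \<in> S)) = f S"
proof -
  let ?x = "\<lambda>j. of_bool (j \<in> S) :: real"
  obtain \<sigma> where \<sigma>: "orders_nonincreasingly n ?x \<sigma>"
    using orders_nonincreasingly_exists by blast
  obtain k where k: "k \<le> n" "\<And>j. j \<in> {1..n} \<Longrightarrow> 1 \<le> ?x (\<sigma> j) \<longleftrightarrow> j \<le> k"
    "\<sigma> ` {1..k} = {v \<in> {1..n}. 1 \<le> ?x v}"
    using orders_nonincreasingly_superlevel[OF \<sigma>] by blast
  \<comment> \<open>An indicator takes only the values 0 and 1, so comparison with the threshold 1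
    determines it.\<close>
  have val: "?x (\<sigma> j) = of_bool (j \<le> k)" if "j \<in> {1..n}" for j
    using k(2)[OF that] by (cases "\<sigma> j \<in> S") auto
  let ?d = "\<lambda>j. f (\<sigma> ` {1..j}) - f (\<sigma> ` {1..j - 1})"
  have "lovasz_ext n f ?x = (\<Sum>j=1..n. of_bool (j \<le> k) * ?d j)"
    unfolding lovasz_ext_eq[OF \<sigma>] lovasz_sum_def by (intro sum.cong refl) (simp only: val)
  also have "\<dots> = (\<Sum>j=1..k. ?d j)"
    using k(1) by (intro sum.mono_neutral_cong_right) auto
  also have "\<dots> = f (\<sigma> ` {1..k})"
    using sum_marginals[of f \<sigma> k] norm by simp
  also have "\<sigma> ` {1..k} = S"
    unfolding k(3) using S by (auto simp: of_bool_def split: if_splits)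
  finally show ?thesis .
qed

text \<open>Together with nonemptiness, this makes the \<open>Min\<close> over all partitions a
  genuine minimum.\<close>

lemma finite_ordered_partitions: "finite (ordered_partitions n m)"
proof (rule finite_subset)
  show "ordered_partitions n m \<subseteq> {1..m} \<rightarrow>\<^sub>E Pow {1..n}"
    by (auto simp: ordered_partitions_def)
qed (intro finite_PiE; simp)

lemma ordered_partitions_nonempty:
  assumes "m \<ge> 1"
  shows "ordered_partitions n m \<noteq> {}"
proof -
  have "(\<lambda>i\<in>{1..m}. if i = 1 then {1..n} else {}) \<in> ordered_partitions n m"
    using assms by (auto simp: ordered_partitions_def disjoint_family_on_def split: if_splits)
  then show ?thesis by blast
qed

text \<open>The blocks cover the ground set, so each \<open>j\<close> gets a summand 1 from the
  block containing it.\<close>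

lemma feasible_indicator:
  assumes "\<pi> \<in> ordered_partitions n m"
  shows "feasible n m (\<lambda>i j. of_bool (j \<in> \<pi> i))"
  unfolding feasible_def
proof (intro conjI ballI)
  fix j assume "j \<in> {1..n}"
  then obtain i where i: "i \<in> {1..m}" "j \<in> \<pi> i"
    using assms unfolding ordered_partitions_def by blast
  then have "1 = (of_bool (j \<in> \<pi> i) :: real)" by simp
  also have "\<dots> \<le> (\<Sum>i=1..m. of_bool (j \<in> \<pi> i))"
    using i(1) by (intro member_le_sum) auto
  finally show "1 \<le> (\<Sum>i=1..m. of_bool (j \<in> \<pi> i) :: real)" .
qed simp

theorem theorem7:
  fixes n m :: nat
    and f :: "nat \<Rightarrow> nat set \<Rightarrow> real"
    and x :: "nat \<Rightarrow> nat \<Rightarrow> real"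
    and block :: "nat \<Rightarrow> nat"
    and A :: "nat \<Rightarrow> nat set"
  assumes "m \<ge> 1"
    and normalized: "\<And>i. i \<in> {1..m} \<Longrightarrow> f i {} = 0"
    and monotone: "\<And>i. i \<in> {1..m} \<Longrightarrow> mono_on (Pow {1..n}) (f i)"
    and submodular: "\<And>i. i \<in> {1..m} \<Longrightarrow> submodular_on {1..n} (f i)"
    and optimal: "is_arg_min (\<lambda>y. Max ((\<lambda>i. lovasz_ext n (f i) (y i)) ` {1..m})) (feasible n m) x"
    and block: "\<And>j. j \<in> {1..n} \<Longrightarrow> is_arg_max (\<lambda>i. x i j) (\<lambda>i. i \<in> {1..m}) (block j)"
    and A: "\<And>i. i \<in> {1..m} \<Longrightarrow> A i = {j \<in> {1..n}. block j = i}"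
  shows "Max ((\<lambda>i. f i (A i)) ` {1..m})
       \<le> real m * Min ((\<lambda>\<pi>. Max ((\<lambda>i. f i (\<pi> i)) ` {1..m})) ` ordered_partitions n m)"
proof -
  let ?obj = "\<lambda>y. Max ((\<lambda>i. lovasz_ext n (f i) (y i)) ` {1..m})"
  have feas: "feasible n m x" and opt: "\<And>y. feasible n m y \<Longrightarrow> ?obj x \<le> ?obj y"
    using optimal by (auto simp: is_arg_min_linorder)
  have rounding: "f i (A i) \<le> real m * ?obj x" if i: "i \<in> {1..m}" for i
  proof -
    \<comment> \<open>The superlevel bound is applied with \<open>t = 1 / real m\<close> and
      \<open>S = A i\<close>.\<close>
    have "(1 / real m) * f i (A i) \<le> lovasz_ext n (f i) (x i)"
    proof (rule lovasz_ext_ge_superlevel[OF normalized[OF i] monotone[OF i]])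
      show "0 \<le> x i j" if "j \<in> {1..n}" for j
        using feas i that by (auto simp: feasible_def)
      show "A i \<subseteq> {1..n}" using A[OF i] by auto
      show "1 / real m \<le> x i j" if "j \<in> A i" for j
      proof -
        have j: "j \<in> {1..n}" "block j = i" using that A[OF i] by auto
        have "1 \<le> (\<Sum>i'=1..m. x i' j)" using feas j by (auto simp: feasible_def)
        \<comment> \<open>Since \<open>block j = i\<close> maximizes the \<open>j\<close>-th
          coordinate, each of the \<open>m\<close> summands is at most \<open>x i j\<close>.\<close>
        also have "\<dots> \<le> (\<Sum>i'=1..m. x i j)"
          using block[OF j(1)] j(2) by (intro sum_mono) (auto simp: is_arg_max_linorder)
        finally show ?thesis using \<open>m \<ge> 1\<close> by (simp add: field_simps)
      qed
    qed simp
    also have "\<dots> \<le> ?obj x" using i by (intro Max_ge) auto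
    finally show ?thesis using \<open>m \<ge> 1\<close> by (simp add: field_simps)
  qed
  have relaxation: "?obj x \<le> Max ((\<lambda>i. f i (\<pi> i)) ` {1..m})"
    if \<pi>: "\<pi> \<in> ordered_partitions n m" for \<pi>
  proof -
    have "lovasz_ext n (f i) (\<lambda>j. of_bool (j \<in> \<pi> i)) = f i (\<pi> i)" if "i \<in> {1..m}" for i
      using that \<pi> normalized by (intro lovasz_ext_indicator) (auto simp: ordered_partitions_def)
    then have "?obj (\<lambda>i j. of_bool (j \<in> \<pi> i)) = Max ((\<lambda>i. f i (\<pi> i)) ` {1..m})"
      by (simp cong: image_cong_simp)
    with opt[OF feasible_indicator[OF \<pi>]] show ?thesis by simp
  qed
  have "Max ((\<lambda>i. f i (A i)) ` {1..m}) \<le> real m * ?obj x"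
    using \<open>m \<ge> 1\<close> rounding by (intro Max.boundedI) auto
  also have "?obj x \<le> Min ((\<lambda>\<pi>. Max ((\<lambda>i. f i (\<pi> i)) ` {1..m})) ` ordered_partitions n m)"
    using relaxation finite_ordered_partitions ordered_partitions_nonempty[OF \<open>m \<ge> 1\<close>]
    by (intro Min.boundedI) auto
  finally show ?thesis
    by (simp add: mult_left_mono)
qed

end
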